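(* Let $F$ be an arbitrary field, let $n\ge5$ be an odd integer and let $r=(n+1)/2$. Let $B$ be the matrix associated to the kernel of the contraction map $f:\wedge^nE\to\wedge^{n-2}E$, that is, to the linear sections $\Pi_\alpha=0$, $\alpha\in I(n-2,2n)$, that define the Lagrangian-Grassmannian $L(n,2n)$ in the Grassmannian $G(n,2n)$. Then $B$ is the direct sum $$B=\mathcal L_r^{\,n}\oplus\Big(\bigoplus_{k=0}^{r-3}\Big(\bigoplus_{\substack{1\le a_1<a_2<\cdots<a_{2k+1}\le 2n\\ a_i+a_j\ne 2n+1}}\mathcal L_{k+2}^{(a_1,a_2,\ldots,a_{2k+1})}\Big)\Big),$$ where $\mathcal L_r^{\,n}$ is the direct sum of $n$ copies of $\mathcal L_r$ and $\mathcal L_{k+2}^{(a_1,a_2,\ldots,a_{2k+1})}\cong\mathcal L_{k+2}$ (the matrices are equivalent) for $0\le k\le r-3$.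
   Context: Write $C^a_b=\binom ab$ and $I(d,N)=\{\alpha=(\alpha_1,\ldots,\alpha_d): 1\le\alpha_1<\cdots<\alpha_d\le N\}$. Contraction map. $E$ is a symplectic vector space of dimension $2n$ over $F$ with form $\langle\ ,\ \rangle$, and $f(w_1\wedge\cdots\wedge w_n)=\sum_{1\le s<t\le n}\langle w_s,w_t\rangle\, w_1\wedge\cdots\wedge\widehat{w}_s\wedge\cdots\wedge\widehat{w}_t\wedge\cdots\wedge w_n$. $G(n,2n)$ is the Grassmannian of $n$-dimensional subspaces of $E$ and $L(n,2n)=G(n,2n)\cap\mathbb P(\ker f)$ is the variety of the isotropic ones. The matrix $B$. For $\alpha\in I(n-2,2n)$ let $\Pi_\alpha=\sum_{i=1}^n c_{i,\alpha,2n-i+1}X_{i,\alpha,2n-i+1}$, a linear polynomial in the variables $X_\beta$ (Plücker coordinates), $\beta\in I(n,2n)$, where $c_{i,\alpha,2n-i+1}=1$ if the set $\{i,\alpha_1,\ldots,\alpha_{n-2},2n-i+1\}$ has exactly $n$ elements, in which case $X_{i,\alpha,2n-i+1}=X_\beta$ with $\beta$ the increasing sequence formed by this set, and $c_{i,\alpha,2n-i+1}=0$ otherwise. The equations $\Pi_\alpha=0$ are the linear system describing $\ker f$ in Plücker coordinates. $B$ is the $C^{2n}_{n-2}\times C^{2n}_n$ matrix of this system, with rows indexed by $\alpha\in I(n-2,2n)$ and columns by $\beta\in I(n,2n)$: its $(\alpha,\beta)$ entry is $1$ if $\{i,\alpha_1,\ldots,\alpha_{n-2},2n-i+1\}=\{\beta_1,\ldots,\beta_n\}$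 for some $1\le i\le n$, and $0$ otherwise. The matrices $\mathcal L_k$. Let $I_s$ be the $s\times s$ identity matrix. $M_1\sqcup\cdots\sqcup M_t$ denotes the matrix obtained by placing $M_1,\ldots,M_t$ (of non-increasing heights) side by side with their bottom rows aligned and filling the empty positions at the upper right with zeros. For a matrix $A$ with $s$ columns, $A(I_s)$ denotes $A$ with $I_s$ placed below it. For $k\ge1$ let $A^0_k=D_k\sqcup D_{k-1}\sqcup\cdots\sqcup D_1$, where $D_j$ is the $(j+1)\times j$ matrix consisting of a row of $j$ ones on top of $I_j$. For $\ell\ge0$ let $$A_k^{\ell+1}=A_k^\ell\big(I_{C^{k+\ell+1}_{\ell+2}}\big)\sqcup A_{k-1}^\ell\big(I_{C^{k+\ell}_{\ell+2}}\big)\sqcup\cdots\sqcup A_1^\ell\big(I_{C^{\ell+2}_{\ell+2}}\big).$$ For $k\ge3$, $\mathcal L_k=A_k^{k-3}$, which has $C^{2k-2}_{k-2}$ rows, $C^{2k-2}_{k-1}$ columns, $k$ ones in each row and $k-1$ ones in each column. $\mathcal L_2$ denotes the $1\times2$ matrix $(1\ \ 1)$.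
   Formalization: The printed formula is false (for n=5 it gives 30 of the 120 rows of B). Corrected: 2n copies of L_r instead of n; the tuples (a_i) labelling L_{k+2} have length n-2-2k instead of 2k+1; the 2^n zero columns of B appear as an explicit summand. *)

theory Defs
  imports "Jordan_Normal_Form.Matrix" "HOL-Combinatorics.Permutations" "HOL-Library.Sublist"
begin

section \<open>Index sequences\<close>

definition index_set :: "nat \<Rightarrow> nat \<Rightarrow> nat list set" where
  "index_set d N = {\<alpha>. length \<alpha> = d \<and> sorted_wrt (<) \<alpha> \<and> set \<alpha> \<subseteq> {1..N}}"

text \<open>The same sequences in lexicographic order, which numbers the rows and columns below.
  All results are up to permutations of rows and columns, so this choice is immaterial.\<close>

definition index_list :: "nat \<Rightarrow> nat \<Rightarrow> nat list list" where
  "index_list d N = filter (\<lambda>\<alpha>. length \<alpha> = d) (subseqs [1..<Suc N])"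

lemma distinct_index_list: "distinct (index_list d N)"
  unfolding index_list_def
  by (intro distinct_filter) (metis distinct_map distinct_set_subseqs distinct_upt)

lemma set_index_list: "set (index_list d N) = index_set d N"
proof (rule subset_antisym; rule subsetI)
  fix \<alpha> assume "\<alpha> \<in> set (index_list d N)"
  then have l: "length \<alpha> = d" and s: "subseq \<alpha> [1..<Suc N]"
    by (auto simp: index_list_def)
  from s obtain A where A: "\<alpha> = nths [1..<Suc N] A"
    by (auto simp: subseq_conv_nths)
  have "sorted_wrt (<) \<alpha>"
    unfolding A strict_sorted_iff by (auto simp: sorted_nths distinct_nthsI simp del: upt_Suc)
  moreover have "set \<alpha> \<subseteq> {1..N}"
    unfolding A using set_nths_subset[of "[1..<Suc N]" A] by (auto simp del: upt_Suc)
  ultimately show "\<alpha> \<in> index_set d N" using l by (simp add: index_set_def)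
next
  fix \<alpha> assume a: "\<alpha> \<in> index_set d N"
  then have "set \<alpha> \<in> set ` set (subseqs [1..<Suc N])"
    by (intro subset_subseqs) (auto simp: index_set_def)
  then obtain \<beta> where \<beta>: "\<beta> \<in> set (subseqs [1..<Suc N])" "set \<beta> = set \<alpha>" by auto
  from \<beta>(1) obtain A where A: "\<beta> = nths [1..<Suc N] A"
    by (auto simp: subseq_conv_nths simp del: upt_Suc)
  have "sorted_wrt (<) \<beta>"
    unfolding A strict_sorted_iff by (auto simp: sorted_nths distinct_nthsI simp del: upt_Suc)
  with a \<beta>(2) have "\<beta> = \<alpha>" by (simp add: index_set_def strict_sorted_equal)
  with \<beta>(1) a show "\<alpha> \<in> set (index_list d N)" by (simp add: index_list_def index_set_def)
qed

lemma length_index_list: "length (index_list d N) = N choose d"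
proof -
  have dist: "distinct (map set (subseqs [1..<Suc N]))"
    by (rule distinct_set_subseqs) simp
  have len: "card (set \<alpha>) = length \<alpha>" if "\<alpha> \<in> set (subseqs [1..<Suc N])" for \<alpha>
    using subseqs_distinctD[OF that] by (simp add: distinct_card)
  have "length (index_list d N) = length (filter (\<lambda>\<alpha>. card (set \<alpha>) = d) (subseqs [1..<Suc N]))"
    unfolding index_list_def
    by (intro arg_cong[of _ _ length] filter_cong) (simp_all add: len del: upt_Suc in_set_subseqs)
  also have "\<dots> = length (filter (\<lambda>A. card A = d) (map set (subseqs [1..<Suc N])))"
    by (simp add: filter_map o_def del: upt_Suc)
  also have "\<dots> = card (set (filter (\<lambda>A. card A = d) (map set (subseqs [1..<Suc N]))))"
    using dist by (intro distinct_card[symmetric] distinct_filter)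
  also have "set (filter (\<lambda>A. card A = d) (map set (subseqs [1..<Suc N]))) =
      {A. A \<subseteq> {1..<Suc N} \<and> card A = d}"
    using subseqs_powset[of "[1..<Suc N]"] by (auto simp del: upt_Suc in_set_subseqs)
  also have "card \<dots> = N choose d"
    by (subst n_subsets) auto
  finally show ?thesis .
qed

section \<open>The matrix B\<close>

text \<open>The linear form \<open>\<Pi>\<^sub>\<alpha>\<close>, as a function of the vector \<open>X\<close> of Pluecker coordinates.\<close>

definition Pi_form :: "nat \<Rightarrow> nat list \<Rightarrow> (nat list \<Rightarrow> 'a) \<Rightarrow> 'a :: field" where
  "Pi_form n \<alpha> X = (\<Sum>i = 1..n.
     let S = {i, 2 * n - i + 1} \<union> set \<alpha>
     in (if card S = n then 1 else 0) * X (sorted_list_of_set S))"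

definition B_entry :: "nat \<Rightarrow> nat list \<Rightarrow> nat list \<Rightarrow> 'a :: field" where
  "B_entry n \<alpha> \<beta> = (if \<exists>i\<in>{1..n}. {i, 2 * n - i + 1} \<union> set \<alpha> = set \<beta> then 1 else 0)"

definition incidence_mat :: "nat \<Rightarrow> nat list list \<Rightarrow> nat list list \<Rightarrow> 'a :: field mat" where
  "incidence_mat n rs cs =
     mat (length rs) (length cs) (\<lambda>(i, j). B_entry n (rs ! i) (cs ! j))"

definition B_mat :: "nat \<Rightarrow> 'a :: field mat" where
  "B_mat n = incidence_mat n (index_list (n - 2) (2 * n)) (index_list n (2 * n))"

lemma Pi_form_eq_B_entry:
  fixes X :: "nat list \<Rightarrow> 'a :: field"
  assumes n: "n \<ge> 2" and \<alpha>: "\<alpha> \<in> index_set (n - 2) (2 * n)"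
  shows "Pi_form n \<alpha> X = (\<Sum>\<beta>\<in>index_set n (2 * n). B_entry n \<alpha> \<beta> * X \<beta>)"
proof -
  define S where "S i = {i, 2 * n - i + 1} \<union> set \<alpha>" for i
  define J where "J = {i\<in>{1..n}. card (S i) = n}"
  define g where "g i = sorted_list_of_set (S i)" for i
  have card\<alpha>: "card (set \<alpha>) = n - 2"
    using \<alpha> by (metis (mono_tags, lifting) distinct_card index_set_def mem_Collect_eq strict_sorted_iff)
  have sub: "set \<alpha> \<subseteq> {1..2*n}" using \<alpha> by (auto simp: index_set_def)
  have J_notin: "i \<notin> set \<alpha>" "2 * n - i + 1 \<notin> set \<alpha>" if "i \<in> J" for i
  proof -
    have "card (S i) = n" using that by (simp add: J_def)
    moreover have "card (S i) \<le> Suc (card (set \<alpha>))" if "i \<in> set \<alpha> \<or> 2 * n - i + 1 \<in> set \<alpha>"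
      using that by (auto simp: S_def insert_absorb card_insert_if)
    ultimately show "i \<notin> set \<alpha>" "2 * n - i + 1 \<notin> set \<alpha>" using n card\<alpha> by fastforce+
  qed
  have setg: "set (g i) = S i" for i
    unfolding g_def by (rule set_sorted_list_of_set) (simp add: S_def)
  have inj: "inj_on g J"
  proof (rule inj_onI)
    fix i j assume ij: "i \<in> J" "j \<in> J" "g i = g j"
    then have "S i = S j" using setg by metis
    then have "i \<in> S j" by (auto simp: S_def)
    then have "i = j \<or> i = 2 * n - j + 1" using J_notin(1)[OF ij(1)] by (auto simp: S_def)
    then show "i = j" using ij(1,2) by (auto simp: J_def)
  qed
  have fin: "finite (index_set n (2*n))" by (simp flip: set_index_list)
  have gI: "g ` J \<subseteq> index_set n (2 * n)"
  proof (rule image_subsetI)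
    fix i assume i: "i \<in> J"
    have "length (g i) = n" using i unfolding g_def J_def by simp
    moreover have "sorted_wrt (<) (g i)" unfolding g_def by (rule strict_sorted_list_of_set)
    moreover have "set (g i) \<subseteq> {1..2 * n}"
      using sub i unfolding setg by (auto simp: S_def J_def)
    ultimately show "g i \<in> index_set n (2 * n)" by (simp add: index_set_def)
  qed
  have "Pi_form n \<alpha> X = (\<Sum>i\<in>J. X (g i))"
    unfolding Pi_form_def Let_def J_def S_def g_def
    by (subst sum.inter_filter) (auto intro!: sum.cong)
  also have "\<dots> = (\<Sum>\<beta>\<in>g ` J. X \<beta>)" using inj by (simp add: sum.reindex)
  also have "\<dots> = (\<Sum>\<beta>\<in>g ` J. B_entry n \<alpha> \<beta> * X \<beta>)"
    using setg by (intro sum.cong) (auto simp: B_entry_def S_def J_def)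
  also have "\<dots> = (\<Sum>\<beta>\<in>index_set n (2 * n). B_entry n \<alpha> \<beta> * X \<beta>)"
  proof (rule sum.mono_neutral_left[OF fin gI], rule ballI)
    fix \<beta> assume \<beta>: "\<beta> \<in> index_set n (2 * n) - g ` J"
    have "S i \<noteq> set \<beta>" if i: "i \<in> {1..n}" for i
    proof
      assume eq: "S i = set \<beta>"
      from \<beta> have s: "sorted_wrt (<) \<beta>" "length \<beta> = n" by (auto simp: index_set_def)
      then have "card (S i) = n" by (simp add: eq distinct_card strict_sorted_iff)
      moreover have "g i = \<beta>"
        using s(1) setg[of i] by (intro strict_sorted_equal) (auto simp: g_def eq)
      ultimately show False using \<beta> i by (auto simp: J_def)
    qed
    then show "B_entry n \<alpha> \<beta> * X \<beta> = 0" by (auto simp: B_entry_def S_def)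
  qed
  finally show ?thesis .
qed

section \<open>The matrices \<open>\<L>\<^sub>k\<close>\<close>

text \<open>\<open>A \<squnion> B\<close> for \<open>dim_row B \<le> dim_row A\<close>: side by side, bottom rows aligned.\<close>

definition beside :: "'a :: zero mat \<Rightarrow> 'a mat \<Rightarrow> 'a mat" where
  "beside A B = mat (dim_row A) (dim_col A + dim_col B) (\<lambda>(i, j).
     if j < dim_col A then A $$ (i, j)
     else if i < dim_row A - dim_row B then 0
     else B $$ (i - (dim_row A - dim_row B), j - dim_col A))"

definition beside_list :: "'a :: zero mat list \<Rightarrow> 'a mat" where
  "beside_list Ms = foldr beside Ms (0\<^sub>m 0 0)"

definition D_mat :: "nat \<Rightarrow> 'a :: field mat" where
  "D_mat j = mat 1 j (\<lambda>_. 1) @\<^sub>r 1\<^sub>m j"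

fun A_mat :: "nat \<Rightarrow> nat \<Rightarrow> 'a :: field mat" where
  "A_mat 0 k = beside_list (map D_mat (rev [1..<Suc k]))"
| "A_mat (Suc l) k = beside_list
     (map (\<lambda>j. A_mat l j @\<^sub>r 1\<^sub>m ((j + l + 1) choose (l + 2))) (rev [1..<Suc k]))"

text \<open>Meaningful for \<open>k \<ge> 2\<close> only.\<close>

definition L_mat :: "nat \<Rightarrow> 'a :: field mat" where
  "L_mat k = (if k = 2 then mat 1 2 (\<lambda>_. 1) else A_mat (k - 3) k)"

section \<open>Direct sums and equivalence\<close>

text \<open>Equivalence is by permutations of rows and columns. The direct sum of a list of
  matrices is \<^const>\<open>diag_block_mat\<close>.\<close>

definition perm_equiv :: "'a mat \<Rightarrow> 'a mat \<Rightarrow> bool" where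
  "perm_equiv M N \<longleftrightarrow> dim_row M = dim_row N \<and> dim_col M = dim_col N \<and>
     (\<exists>p q. p permutes {..<dim_row M} \<and> q permutes {..<dim_col M} \<and>
        (\<forall>i<dim_row M. \<forall>j<dim_col M. N $$ (i, j) = M $$ (p i, q j)))"

definition admissible_list :: "nat \<Rightarrow> nat \<Rightarrow> nat list list" where
  "admissible_list n d =
     filter (\<lambda>a. \<forall>x\<in>set a. \<forall>y\<in>set a. x + y \<noteq> 2 * n + 1) (index_list d (2 * n))"

text \<open>The entries of a sequence whose partner \<open>2 n + 1 - x\<close> does not occur in it. Passing from
  \<open>\<alpha>\<close> to \<open>{i, 2 n + 1 - i} \<union> \<alpha>\<close> does not change them, so \<open>B\<close> splits accordingly: the block of
  \<open>a = (a\<^sub>1, \<dots>, a\<^sub>s)\<close> is the submatrix on the rows and columns with unpaired entries \<open>a\<close>.\<close>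

definition unpaired :: "nat \<Rightarrow> nat list \<Rightarrow> nat list" where
  "unpaired n \<alpha> = filter (\<lambda>x. 2 * n + 1 - x \<notin> set \<alpha>) \<alpha>"

definition L_block :: "nat \<Rightarrow> nat list \<Rightarrow> 'a :: field mat" where
  "L_block n a = incidence_mat n
     (filter (\<lambda>\<alpha>. unpaired n \<alpha> = a) (index_list (n - 2) (2 * n)))
     (filter (\<lambda>\<beta>. unpaired n \<beta> = a) (index_list n (2 * n)))"

section \<open>Multiplicities of the blocks\<close>

text \<open>The decomposition has been stated in print with \<open>n\<close> copies of \<open>\<L>\<^sub>r\<close> and with \<open>\<L>\<^sub>k\<^sub>+\<^sub>2\<close> indexed by the
  admissible sequences of length \<open>2 k + 1\<close>. These multiplicities cannot be right: for
  \<open>n = 5\<close> they account for 30 of the 120 rows of \<open>B\<close>, whatever zero columns are added.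
  A row \<open>\<alpha>\<close> of a block \<open>\<L>\<^sub>k\<^sub>+\<^sub>2\<close> contains \<open>k\<close> pairs \<open>{i, 2 n + 1 - i}\<close>, hence
  \<open>n - 2 - 2 k = 2 (r - k) - 3\<close> unpaired entries, and for \<open>\<L>\<^sub>r\<close> the single unpaired entry
  takes \<open>2 n\<close> values. The \<open>2\<^sup>n\<close> columns \<open>\<beta>\<close> without any pair are zero.\<close>

lemma perm_equiv_dim_row: "perm_equiv M N \<Longrightarrow> dim_row M = dim_row N"
  by (simp add: perm_equiv_def)

lemma printed_multiplicities_fail:
  fixes M :: "nat \<Rightarrow> nat list \<Rightarrow> 'a :: field mat"
  assumes n: "n = 5" and r: "r = (n + 1) div 2"
    and M: "\<And>k a. k \<le> r - 3 \<Longrightarrow> a \<in> set (admissible_list n (2 * k + 1)) \<Longrightarrow>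
              perm_equiv (M k a) (L_mat (k + 2))"
  shows "\<not> perm_equiv (B_mat n) (diag_block_mat (replicate n (L_mat r) @
           concat (map (\<lambda>k. map (M k) (admissible_list n (2 * k + 1))) [0..<r - 2]) @ [0\<^sub>m 0 c]))"
proof
  assume *: "perm_equiv (B_mat n) (diag_block_mat (replicate n (L_mat r) @
           concat (map (\<lambda>k. map (M k) (admissible_list n (2 * k + 1))) [0..<r - 2]) @ [0\<^sub>m 0 c]))"
  have r3: "r = 3" using n r by simp
  have "admissible_list 5 1 = index_list 1 10"
    unfolding admissible_list_def
    by (auto simp: filter_id_conv set_index_list index_set_def length_Suc_conv) presburger
  then have "length (admissible_list 5 1) = 10" by (simp add: length_index_list)
  moreover have "length (index_list 3 10) = 120"
    by (simp add: length_index_list numeral_eq_Suc)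
  moreover have "dim_row (L_mat 3 :: 'a mat) = 4"
    by (simp add: L_mat_def beside_list_def beside_def D_mat_def append_rows_def upt_rec)
  moreover have rows: "map (dim_row \<circ> M 0) (admissible_list 5 1) = map (\<lambda>_. 1) (admissible_list 5 1)"
  proof (rule map_cong[OF refl])
    fix a assume "a \<in> set (admissible_list 5 1)"
    then have "perm_equiv (M 0 a) (L_mat 2)" using M[of 0 a] n r3 by (simp add: numeral_2_eq_2)
    then show "(dim_row \<circ> M 0) a = 1" by (simp add: perm_equiv_def L_mat_def)
  qed
  moreover have "sum_list (map (dim_row \<circ> M 0) (admissible_list 5 1)) =
      length (admissible_list 5 1)"
    unfolding rows by (simp add: sum_list_triv)
  ultimately show False
    using perm_equiv_dim_row[OF *]
    by (simp add: n r3 dim_diag_block_mat B_mat_def incidence_mat_def sum_list_replicate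
        sum_list_triv upt_rec)
qed

end

theory Submission
  imports Defs
begin

text \<open>Adding a pair \<open>{i, 2 n + 1 - i}\<close> to \<open>\<alpha>\<close> leaves its set \<open>a\<close> of unpaired entries unchanged, so \<open>B\<close>
  splits into blocks indexed by \<open>a\<close>. If \<open>a\<close> has \<open>n - 2 - 2 k\<close> elements, then \<open>2 k + 2\<close> pairs avoid
  \<open>a\<close>, and the block is the inclusion matrix of the \<open>k\<close>-subsets against the \<open>(k + 1)\<close>-subsets of a
  set with \<open>2 k + 2\<close> elements. In lexicographic order the inclusion matrices of a finite set
  decompose by the least element of the larger subset, and this recursion is the one that
  defines \<open>A\<^sub>k\<^sup>l\<close>; hence \<open>\<L>\<^sub>k\<^sub>+\<^sub>2\<close> is exactly this inclusion matrix.\<close>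

section \<open>Matrices with labelled rows and columns\<close>

text \<open>Keeping the labels turns a permutation of rows or columns into a rearrangement of lists,
  and a direct sum into a concatenation of lists.\<close>

definition label_mat :: "('r \<Rightarrow> 'c \<Rightarrow> 'a) \<Rightarrow> 'r list \<Rightarrow> 'c list \<Rightarrow> 'a mat" where
  "label_mat f rs cs = mat (length rs) (length cs) (\<lambda>(i, j). f (rs ! i) (cs ! j))"

lemma dim_label_mat [simp]:
  "dim_row (label_mat f rs cs) = length rs" "dim_col (label_mat f rs cs) = length cs"
  by (simp_all add: label_mat_def)

lemma index_label_mat [simp]:
  "i < length rs \<Longrightarrow> j < length cs \<Longrightarrow> label_mat f rs cs $$ (i, j) = f (rs ! i) (cs ! j)"
  by (simp add: label_mat_def)

lemma label_mat_map_cong: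
  assumes "\<And>x y. x \<in> set rs \<Longrightarrow> y \<in> set cs \<Longrightarrow> f (g x) (h y) = f' (g' x) (h' y)"
  shows "label_mat f (map g rs) (map h cs) = label_mat f' (map g' rs) (map h' cs)"
  by (rule eq_matI) (auto intro: assms)

lemma incidence_mat_label_mat: "incidence_mat n = label_mat (B_entry n)"
  by (simp add: fun_eq_iff incidence_mat_def label_mat_def)

text \<open>\<open>permute_list\<close> carries a permutation of positions over to the labels, and
  lists with equal multisets differ by such a permutation. Multisets appear since labels may repeat.
  Read from left to right, this yields explicit label lists for the blocks of the direct
  sum.\<close>

lemma perm_equiv_label_mat_iff:
  "perm_equiv (label_mat f rs cs) N \<longleftrightarrow>
     (\<exists>rs' cs'. mset rs' = mset rs \<and> mset cs' = mset cs \<and> N = label_mat f rs' cs')"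
proof
  assume "perm_equiv (label_mat f rs cs) N"
  then obtain p q where dims: "dim_row N = length rs" "dim_col N = length cs"
    and p: "p permutes {..<length rs}" and q: "q permutes {..<length cs}"
    and N: "\<And>i j. i < length rs \<Longrightarrow> j < length cs \<Longrightarrow> N $$ (i, j) = label_mat f rs cs $$ (p i, q j)"
    unfolding perm_equiv_def by auto
  have "N = label_mat f (permute_list p rs) (permute_list q cs)"
  proof (rule eq_matI)
    fix i j
    assume "i < dim_row (label_mat f (permute_list p rs) (permute_list q cs))"
      and "j < dim_col (label_mat f (permute_list p rs) (permute_list q cs))"
    then have ij: "i < length rs" "j < length cs" by simp_all
    moreover have "p i < length rs" "q j < length cs"
      using ij permutes_in_image[OF p] permutes_in_image[OF q] by auto
    ultimately show "N $$ (i, j) = label_mat f (permute_list p rs) (permute_list q cs) $$ (i, j)"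
      by (simp add: N permute_list_nth[OF p] permute_list_nth[OF q])
  qed (simp_all add: dims)
  then show "\<exists>rs' cs'. mset rs' = mset rs \<and> mset cs' = mset cs \<and> N = label_mat f rs' cs'"
    using p q by (metis mset_permute_list)
next
  assume "\<exists>rs' cs'. mset rs' = mset rs \<and> mset cs' = mset cs \<and> N = label_mat f rs' cs'"
  then obtain rs' cs' where *: "mset rs' = mset rs" "mset cs' = mset cs"
    and N: "N = label_mat f rs' cs'" by blast
  from * obtain p q where p: "p permutes {..<length rs}" "permute_list p rs = rs'"
    and q: "q permutes {..<length cs}" "permute_list q cs = cs'"
    by (metis mset_eq_permutation)
  have "N $$ (i, j) = label_mat f rs cs $$ (p i, q j)" if ij: "i < length rs" "j < length cs" for i j
  proof -
    have "p i < length rs" "q j < length cs"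
      using ij permutes_in_image[OF p(1)] permutes_in_image[OF q(1)] by auto
    with ij show ?thesis
      unfolding N p(2)[symmetric] q(2)[symmetric]
      by (simp add: permute_list_nth[OF p(1)] permute_list_nth[OF q(1)])
  qed
  moreover have "length rs' = length rs" "length cs' = length cs"
    using p(2) q(2) by auto
  ultimately show "perm_equiv (label_mat f rs cs) N"
    unfolding perm_equiv_def using p(1) q(1) by (auto simp: N)
qed

lemma perm_equiv_label_matI:
  assumes "distinct rs" "distinct rs'" "set rs = set rs'"
    and "distinct cs" "distinct cs'" "set cs = set cs'"
  shows "perm_equiv (label_mat f rs cs) (label_mat f rs' cs')"
  using assms unfolding perm_equiv_label_mat_iff by (metis set_eq_iff_mset_eq_distinct)

text \<open>\<open>sorted_wrt\<close> compares each block with all later ones, in both directions.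
  So the hypothesis says that f vanishes outside the diagonal blocks of the concatenated
  labels.\<close>

lemma diag_block_mat_label_mat:
  fixes f :: "'r \<Rightarrow> 'c \<Rightarrow> 'a :: zero"
  assumes "sorted_wrt (\<lambda>p q. (\<forall>x\<in>set (fst p). \<forall>y\<in>set (snd q). f x y = 0) \<and>
      (\<forall>x\<in>set (fst q). \<forall>y\<in>set (snd p). f x y = 0)) ps"
  shows "diag_block_mat (map (\<lambda>p. label_mat f (fst p) (snd p)) ps) =
    label_mat f (concat (map fst ps)) (concat (map snd ps))"
  using assms
proof (induction ps)
  case Nil
  show ?case by (rule eq_matI) simp_all
next
  case (Cons p ps)
  have right: "f x y = 0" if "x \<in> set (fst p)" "y \<in> set (concat (map snd ps))" for x y
    using that Cons.prems by auto
  have left: "f x y = 0" if "x \<in> set (concat (map fst ps))" "y \<in> set (snd p)" for x y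
    using that Cons.prems by auto
  have IH: "diag_block_mat (map (\<lambda>p. label_mat f (fst p) (snd p)) ps) =
      label_mat f (concat (map fst ps)) (concat (map snd ps))"
    using Cons by simp
  define R C where "R = concat (map fst ps)" and "C = concat (map snd ps)"
  show ?case
    unfolding list.map diag_block_mat.simps IH concat.simps R_def[symmetric] C_def[symmetric] Let_def
  proof (rule eq_matI)
    fix i j assume "i < dim_row (label_mat f (fst p @ R) (snd p @ C))"
      and "j < dim_col (label_mat f (fst p @ R) (snd p @ C))"
    then show "four_block_mat (label_mat f (fst p) (snd p))
        (0\<^sub>m (dim_row (label_mat f (fst p) (snd p))) (dim_col (label_mat f R C)))
        (0\<^sub>m (dim_row (label_mat f R C)) (dim_col (label_mat f (fst p) (snd p))))
        (label_mat f R C) $$ (i, j) = label_mat f (fst p @ R) (snd p @ C) $$ (i, j)"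
      \<comment> \<open>The two instances are entries of the lower left and of the upper right
        quadrant.\<close>
      using left[of "R ! (i - length (fst p))" "snd p ! j"]
        right[of "fst p ! i" "C ! (j - length (snd p))"]
      by (auto simp: nth_append R_def[symmetric] C_def[symmetric] simp del: set_concat)
  qed simp_all
qed

section \<open>The matrices \<open>\<L>\<^sub>k\<close> as inclusion matrices\<close>

text \<open>Subsets with the head of the list precede those without it. This order makes the
  recursion for inclusion matrices an equality of matrices, not just an equivalence.\<close>

fun subsets_list :: "nat \<Rightarrow> 'a list \<Rightarrow> 'a set list" where
  "subsets_list 0 xs = [{}]"
| "subsets_list (Suc d) [] = []"
| "subsets_list (Suc d) (x # xs) = map (insert x) (subsets_list d xs) @ subsets_list (Suc d) xs"

section \<open>Enumeration of the subsets of a given size\<close>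

lemma length_subsets_list: "length (subsets_list d xs) = length xs choose d"
  by (induction d xs rule: subsets_list.induct) simp_all

lemma set_subsets_list:
  "distinct xs \<Longrightarrow> set (subsets_list d xs) = {T. T \<subseteq> set xs \<and> card T = d}"
proof (induction d xs rule: subsets_list.induct)
  case (1 xs)
  \<comment> \<open>An infinite set also has \<open>card\<close> 0, so the emptiness of T rests on
    its finiteness.\<close>
  then show ?case using finite_subset[OF _ finite_set[of xs]] by auto
next
  case (3 d x xs)
  have "T \<in> insert x ` {T. T \<subseteq> set xs \<and> card T = d} \<longleftrightarrow> T \<subseteq> set (x # xs) \<and> card T = Suc d \<and> x \<in> T" for T
  proof
    assume "T \<in> insert x ` {T. T \<subseteq> set xs \<and> card T = d}"
    then obtain U where U: "T = insert x U" "U \<subseteq> set xs" "card U = d" by blast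
    then have "x \<notin> U" "finite U" using 3(3) finite_subset[OF U(2)] by auto
    with U show "T \<subseteq> set (x # xs) \<and> card T = Suc d \<and> x \<in> T" by auto
  next
    assume T: "T \<subseteq> set (x # xs) \<and> card T = Suc d \<and> x \<in> T"
    then have "T = insert x (T - {x})" "T - {x} \<subseteq> set xs" "card (T - {x}) = d" by auto
    then show "T \<in> insert x ` {T. T \<subseteq> set xs \<and> card T = d}" by blast
  qed
  with 3 show ?case by (auto simp: subset_insert)
qed simp

lemma distinct_subsets_list: "distinct xs \<Longrightarrow> distinct (subsets_list d xs)"
proof (induction d xs rule: subsets_list.induct)
  case (3 d x xs)
  then have "inj_on (insert x) (set (subsets_list d xs))"
    by (auto simp: inj_on_def set_subsets_list)
  with 3 show ?case by (auto simp: distinct_map set_subsets_list)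
qed simp_all

definition incl_entry :: "'a set \<Rightarrow> 'a set \<Rightarrow> 'b :: zero_neq_one" where
  "incl_entry S T = of_bool (S \<subseteq> T)"

definition incl_mat :: "nat \<Rightarrow> 'a list \<Rightarrow> 'b :: zero_neq_one mat" where
  "incl_mat d xs = label_mat incl_entry (subsets_list d xs) (subsets_list (Suc d) xs)"

text \<open>Inclusion between finite sets of equal size is equality. This is the identity matrix
  that A(I_s) has below A.\<close>

lemma label_mat_incl_entry_self:
  assumes "distinct xs"
  shows "label_mat incl_entry (subsets_list d xs) (subsets_list d xs) =
    (1\<^sub>m (length xs choose d) :: 'b :: field mat)"
proof (rule eq_matI)
  fix i j assume "i < dim_row (1\<^sub>m (length xs choose d) :: 'b mat)"
    and "j < dim_col (1\<^sub>m (length xs choose d) :: 'b mat)"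
  then have ij: "i < length (subsets_list d xs)" "j < length (subsets_list d xs)"
    by (simp_all add: length_subsets_list)
  then have *: "subsets_list d xs ! i \<in> {T. T \<subseteq> set xs \<and> card T = d}"
    "subsets_list d xs ! j \<in> {T. T \<subseteq> set xs \<and> card T = d}"
    using assms set_subsets_list nth_mem by blast+
  then have "subsets_list d xs ! i \<subseteq> subsets_list d xs ! j \<longleftrightarrow>
      subsets_list d xs ! i = subsets_list d xs ! j"
    using card_subset_eq[of "subsets_list d xs ! j" "subsets_list d xs ! i"]
      finite_subset[OF _ finite_set[of xs]] by auto
  also have "\<dots> \<longleftrightarrow> i = j"
    using ij by (simp add: nth_eq_iff_index_eq distinct_subsets_list assms)
  finally show "label_mat incl_entry (subsets_list d xs) (subsets_list d xs) $$ (i, j) =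
      (1\<^sub>m (length xs choose d) :: 'b mat) $$ (i, j)"
    using ij by (simp add: incl_entry_def length_subsets_list)
qed (simp_all add: length_subsets_list)

text \<open>\<open>beside\<close> aligns bottom rows, so the zeros it fills in at the upper right
  are exactly the entries in rows \<open>rs\<close> and columns \<open>cs'\<close>.\<close>

lemma label_mat_append_beside:
  fixes f :: "'r \<Rightarrow> 'c \<Rightarrow> 'a :: zero"
  assumes "\<And>x y. x \<in> set rs \<Longrightarrow> y \<in> set cs' \<Longrightarrow> f x y = 0"
  shows "label_mat f (rs @ rs') (cs @ cs') =
    beside (label_mat f rs cs @\<^sub>r label_mat f rs' cs) (label_mat f rs' cs')"
  by (rule eq_matI) (auto simp: beside_def append_rows_def nth_append assms)

text \<open>Split rows and columns by whether they contain x. If both do, x can be cancelled. If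
  only the column does, the remaining sets have equal size and give the identity. If only the row
  does, the entry is zero. If neither does, the inclusion matrix of \<open>xs\<close>
  remains.\<close>

lemma incl_mat_Cons:
  assumes "distinct (x # xs)"
  shows "(incl_mat (Suc d) (x # xs) :: 'b :: field mat) =
    beside (incl_mat d xs @\<^sub>r 1\<^sub>m (length xs choose Suc d)) (incl_mat (Suc d) xs)"
proof -
  have x: "x \<notin> T" if "T \<in> set (subsets_list e xs)" for T e
    using that assms by (auto simp: set_subsets_list)
  have "label_mat incl_entry (map (insert x) (subsets_list d xs))
      (map (insert x) (subsets_list (Suc d) xs)) =
      (label_mat incl_entry (map id (subsets_list d xs)) (map id (subsets_list (Suc d) xs)) :: 'b mat)"
    using x by (intro label_mat_map_cong) (auto simp: incl_entry_def subset_insert)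
  moreover have "label_mat incl_entry (map id (subsets_list (Suc d) xs))
      (map (insert x) (subsets_list (Suc d) xs)) =
      (label_mat incl_entry (map id (subsets_list (Suc d) xs)) (map id (subsets_list (Suc d) xs)) :: 'b mat)"
    using x by (intro label_mat_map_cong) (auto simp: incl_entry_def subset_insert)
  ultimately show ?thesis
    using assms x unfolding incl_mat_def subsets_list.simps
    by (subst label_mat_append_beside) (auto simp: incl_entry_def label_mat_incl_entry_self)
qed

lemma incl_mat_0: "incl_mat 0 xs = (mat 1 (length xs) (\<lambda>_. 1) :: 'b :: field mat)"
  by (rule eq_matI) (auto simp: incl_mat_def incl_entry_def length_subsets_list)

section \<open>Identification of the recursion with the definition of A_k^l\<close>

lemma beside_dim_col_0: "dim_col B = 0 \<Longrightarrow> beside A B = A"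
  by (rule eq_matI) (auto simp: beside_def)

text \<open>This iterates \<open>incl_mat_Cons\<close>, removing the elements of \<open>xs\<close>
  one by one; the summand \<open>M j\<close> belongs to the suffix of length j + d. With M abstract,
  both clauses of \<open>A_mat\<close> are covered at once.\<close>

lemma beside_list_rec_incl_mat:
  assumes M: "\<And>j ys. 0 < j \<Longrightarrow> distinct (ys :: 'a list) \<Longrightarrow> length ys = j + d \<Longrightarrow>
      M j = (incl_mat d ys @\<^sub>r 1\<^sub>m ((j + d) choose Suc d) :: 'b :: field mat)"
    and "0 < k" "distinct (xs :: 'a list)" "length xs = Suc (k + d)"
  shows "beside_list (map M (rev [1..<Suc k])) = incl_mat (Suc d) xs"
  using assms(2-)
proof (induction k arbitrary: xs)
  case (Suc k)
  then obtain x ys where xs: "xs = x # ys" by (cases xs) auto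
  have Mk: "M (Suc k) = incl_mat d ys @\<^sub>r 1\<^sub>m (length ys choose Suc d)"
    using Suc.prems M[of "Suc k" ys] by (simp add: xs)
  have step: "beside_list (map M (rev [1..<Suc (Suc k)])) =
      beside (M (Suc k)) (beside_list (map M (rev [1..<Suc k])))"
    by (simp add: beside_list_def)
  show ?case
  proof (cases "k = 0")
    case True
    \<comment> \<open>The list ends in the 0 by 0 matrix, whereas the inclusion matrix of
      \<open>ys\<close> has one row and no columns. On the right of \<open>beside\<close> both are
      neutral.\<close>
    then have "dim_col (incl_mat (Suc d) ys :: 'b mat) = 0"
      using Suc.prems by (simp add: incl_mat_def length_subsets_list xs)
    then show ?thesis
      unfolding step Mk xs using Suc.prems True
      by (subst incl_mat_Cons) (simp_all add: beside_dim_col_0 beside_list_def xs)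
  next
    case False
    then show ?thesis
      unfolding step Mk xs using Suc.prems Suc.IH[of ys]
      by (subst incl_mat_Cons) (simp_all add: xs)
  qed
qed simp

lemma A_mat_eq_incl_mat:
  assumes "0 < k" "distinct (xs :: 'a list)" "length xs = Suc (k + l)"
  shows "A_mat l k = (incl_mat (Suc l) xs :: 'b :: field mat)"
  using assms
proof (induction l arbitrary: k xs)
  case 0
  \<comment> \<open>Here d = 0: the row of ones in D_j belongs to the empty set, which lies in every
    singleton.\<close>
  show ?case
    unfolding A_mat.simps
    by (rule beside_list_rec_incl_mat) (use 0 in \<open>auto simp: D_mat_def incl_mat_0\<close>)
next
  case (Suc l)
  show ?case
    unfolding A_mat.simps
    by (rule beside_list_rec_incl_mat) (use Suc in auto)
qed

text \<open>For k > 0 the matrix is A_{k+2}^{k-1}, whose ground set has (k + 2) + (k - 1) + 1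
  elements. For k = 0 the two ones express that the empty set lies in two singletons.\<close>

lemma L_mat_eq_incl_mat:
  assumes "distinct xs" "length xs = 2 * k + 2"
  shows "L_mat (k + 2) = (incl_mat k xs :: 'b :: field mat)"
proof (cases k)
  case 0
  with assms show ?thesis by (simp add: L_mat_def incl_mat_0 numeral_2_eq_2)
next
  case (Suc l)
  with assms show ?thesis by (simp add: L_mat_def A_mat_eq_incl_mat[of _ xs])
qed

section \<open>Paired and unpaired entries\<close>

definition singles :: "nat \<Rightarrow> nat set \<Rightarrow> nat set" where
  "singles n S = {x \<in> S. 2 * n + 1 - x \<notin> S}"

text \<open>A pair {i, 2 n + 1 - i} is represented by its member i \<le> n, here and in
  \<open>free\<close>.\<close>

definition pairs :: "nat \<Rightarrow> nat set \<Rightarrow> nat set" where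
  "pairs n S = {i \<in> {1..n}. i \<in> S \<and> 2 * n + 1 - i \<in> S}"

definition free :: "nat \<Rightarrow> nat set \<Rightarrow> nat set" where
  "free n S = {i \<in> {1..n}. i \<notin> S \<and> 2 * n + 1 - i \<notin> S}"

definition isotropic :: "nat \<Rightarrow> nat set \<Rightarrow> bool" where
  "isotropic n S \<longleftrightarrow> (\<forall>x\<in>S. \<forall>y\<in>S. x + y \<noteq> 2 * n + 1)"

text \<open>For d = n - 2 and d = n these are the row and column labels of
  \<open>L_block n a\<close>.\<close>

definition fibre :: "nat \<Rightarrow> nat \<Rightarrow> nat list \<Rightarrow> nat list list" where
  "fibre n d a = filter (\<lambda>\<alpha>. unpaired n \<alpha> = a) (index_list d (2 * n))"

section \<open>Index sequences, admissible sequences and their underlying sets\<close>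

lemma index_setD:
  assumes "\<alpha> \<in> index_set d N"
  shows "set \<alpha> \<subseteq> {1..N}" "card (set \<alpha>) = d" "length \<alpha> = d" "sorted_wrt (<) \<alpha>"
  using assms by (auto simp: index_set_def strict_sorted_iff distinct_card)

lemma sorted_list_of_set_in_index_set:
  assumes "S \<subseteq> {1..N}" "card S = d"
  shows "sorted_list_of_set S \<in> index_set d N"
  using assms finite_subset[OF assms(1)] by (simp add: index_set_def)

lemma set_admissible_list:
  "a \<in> set (admissible_list n d) \<longleftrightarrow> a \<in> index_set d (2 * n) \<and> isotropic n (set a)"
  by (auto simp: admissible_list_def isotropic_def set_index_list)

lemma distinct_admissible_list: "distinct (admissible_list n d)"
  by (simp add: admissible_list_def distinct_index_list)

lemma distinct_fibre: "distinct (fibre n d a)"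
  by (simp add: fibre_def distinct_index_list)

lemma set_fibre: "set (fibre n d a) = {\<alpha> \<in> index_set d (2 * n). unpaired n \<alpha> = a}"
  by (simp add: fibre_def set_index_list)

lemma set_unpaired: "set (unpaired n \<alpha>) = singles n (set \<alpha>)"
  by (auto simp: unpaired_def singles_def)

lemma unpaired_eq_iff:
  assumes "sorted_wrt (<) \<alpha>" "sorted_wrt (<) a"
  shows "unpaired n \<alpha> = a \<longleftrightarrow> singles n (set \<alpha>) = set a"
proof -
  have "sorted_wrt (<) (unpaired n \<alpha>)"
    using assms(1) by (simp add: unpaired_def sorted_wrt_filter)
  then show ?thesis
    using assms(2) strict_sorted_equal by (metis set_unpaired)
qed

lemma isotropic_singles: "S \<subseteq> {1..2 * n} \<Longrightarrow> isotropic n (singles n S)"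
proof -
  assume S: "S \<subseteq> {1..2 * n}"
  { fix x y assume xy: "x \<in> singles n S" "y \<in> singles n S" "x + y = 2 * n + 1"
    then have "2 * n + 1 - x = y" by simp
    with xy have False by (simp add: singles_def) }
  then show ?thesis by (auto simp: isotropic_def)
qed

lemma isotropic_iff_singles:
  assumes "S \<subseteq> {1..2 * n}"
  shows "isotropic n S \<longleftrightarrow> singles n S = S"
proof
  assume *: "isotropic n S"
  have "2 * n + 1 - x \<notin> S" if "x \<in> S" for x
  proof -
    \<comment> \<open>The bound makes the truncated subtraction exact, so that x and its partner
      really sum to 2 n + 1.\<close>
    have "x \<le> 2 * n" using that assms by auto
    then have "x + (2 * n + 1 - x) = 2 * n + 1" by simp
    with * that show ?thesis unfolding isotropic_def by blast
  qed
  then show "singles n S = S" by (auto simp: singles_def)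
qed (use isotropic_singles[OF assms] in auto)

text \<open>A paired element is either recorded in \<open>pairs\<close> or exceeds n and is the
  reflection of a recorded one. Hence S is determined by its singles and its pairs.\<close>

lemma decompose:
  assumes "S \<subseteq> {1..2 * n}"
  shows "S = singles n S \<union> (pairs n S \<union> (\<lambda>i. 2 * n + 1 - i) ` pairs n S)"
proof (rule Set.set_eqI)
  fix x
  have "x \<in> (\<lambda>i. 2 * n + 1 - i) ` pairs n S" if "x \<in> S" "2 * n + 1 - x \<in> S" "\<not> x \<le> n"
  proof (rule image_eqI)
    have "x \<le> 2 * n" using that assms by auto
    then show "x = 2 * n + 1 - (2 * n + 1 - x)" "2 * n + 1 - x \<in> pairs n S"
      using that by (auto simp: pairs_def)
  qed
  then show "x \<in> S \<longleftrightarrow> x \<in> singles n S \<union> (pairs n S \<union> (\<lambda>i. 2 * n + 1 - i) ` pairs n S)"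
    using assms by (auto simp: singles_def pairs_def)
qed

text \<open>The three parts are disjoint: T lies below n + 1, its reflection above n, and freeness
  keeps A away from both.\<close>

lemma card_decompose:
  assumes "A \<subseteq> {1..2 * n}" "T \<subseteq> free n A"
  shows "card (A \<union> (T \<union> (\<lambda>i. 2 * n + 1 - i) ` T)) = card A + 2 * card T"
proof -
  have T: "T \<subseteq> {1..n}" using assms by (auto simp: free_def)
  have fin: "finite A" "finite T" using assms(1) T finite_subset by blast+
  have "inj_on (\<lambda>i. 2 * n + 1 - i) T"
    by (rule inj_onI) (use T in fastforce)
  moreover have "2 * n + 1 - i \<notin> T" if "i \<in> T" for i
    using subsetD[OF T, of i] subsetD[OF T, of "2 * n + 1 - i"] that by auto
  then have "T \<inter> (\<lambda>i. 2 * n + 1 - i) ` T = {}" by auto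
  moreover have "A \<inter> (T \<union> (\<lambda>i. 2 * n + 1 - i) ` T) = {}"
    using assms by (auto simp: free_def)
  ultimately show ?thesis
    using fin by (simp add: card_Un_disjoint card_image)
qed

lemma pairs_subset_free_singles: "pairs n S \<subseteq> free n (singles n S)"
  by (auto simp: pairs_def free_def singles_def)

lemma singles_subset: "singles n S \<subseteq> S"
  by (auto simp: singles_def)

lemma card_eq_singles_pairs:
  assumes "S \<subseteq> {1..2 * n}"
  shows "card S = card (singles n S) + 2 * card (pairs n S)"
proof -
  have "card S = card (singles n S \<union> (pairs n S \<union> (\<lambda>i. 2 * n + 1 - i) ` pairs n S))"
    using decompose[OF assms] by (rule arg_cong)
  also have "\<dots> = card (singles n S) + 2 * card (pairs n S)"
    using assms singles_subset by (intro card_decompose pairs_subset_free_singles) blast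
  finally show ?thesis .
qed

text \<open>Converse of \<open>decompose\<close>: any set of free pairs may be added to an isotropic
  A, since each new element brings its own partner and gives none to an element of A.\<close>

lemma
  assumes A: "isotropic n A" "A \<subseteq> {1..2 * n}" and T: "T \<subseteq> free n A"
  defines "S \<equiv> A \<union> (T \<union> (\<lambda>i. 2 * n + 1 - i) ` T)"
  shows singles_extend: "singles n S = A"
    and pairs_extend: "pairs n S = T"
    and extend_subset: "S \<subseteq> {1..2 * n}"
proof -
  have T': "i \<in> {1..n}" "i \<notin> A" "2 * n + 1 - i \<notin> A" if "i \<in> T" for i
    using that T by (auto simp: free_def)
  have A': "2 * n + 1 - x \<notin> A" if "x \<in> A" for x
    using that A isotropic_iff_singles by (auto simp: singles_def)
  have invol: "2 * n + 1 - (2 * n + 1 - x) = x" if "x \<in> {1..2 * n}" for x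
    using that by auto
  show sub: "S \<subseteq> {1..2 * n}"
    using A T' by (fastforce simp: S_def)
  have "2 * n + 1 - x \<notin> S" if x: "x \<in> A" for x
  proof
    assume "2 * n + 1 - x \<in> S"
    \<comment> \<open>The partner of x could have been added as a member of T or as a reflection; in
      both cases freeness of T puts x outside A.\<close>
    then consider "2 * n + 1 - x \<in> T" | i where "i \<in> T" "2 * n + 1 - x = 2 * n + 1 - i"
      using A'[OF x] by (auto simp: S_def)
    then show False
    proof cases
      case 1
      then show ?thesis using T'(3)[OF 1] invol[of x] x A(2) by auto
    next
      case (2 i)
      then have "i = x" using T'(1)[of i] x A(2) by fastforce
      then show ?thesis using 2 T' x by auto
    qed
  qed
  moreover have "2 * n + 1 - x \<in> S" if "x \<in> S" "x \<notin> A" for x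
    using that T'(1) by (force simp: S_def)
  ultimately show sing: "singles n S = A"
    by (auto simp: singles_def S_def)
  show "pairs n S = T"
  proof (intro equalityI subsetI)
    fix i assume i: "i \<in> pairs n S"
    then have "i \<notin> A" unfolding sing[symmetric] by (simp add: pairs_def singles_def)
    moreover have "i \<noteq> 2 * n + 1 - j" if "j \<in> T" for j
      using T'(1)[OF that] i by (auto simp: pairs_def)
    ultimately show "i \<in> T" using i by (auto simp: pairs_def S_def)
  qed (use T' in \<open>auto simp: pairs_def S_def\<close>)
qed

text \<open>The map g folds {1..2 n} onto {1..n} by sending x to the smaller member of its pair. It
  is injective on an isotropic set, and \<open>free n A\<close> is the complement of the image of
  A.\<close>

lemma card_free:
  assumes A: "isotropic n A" "A \<subseteq> {1..2 * n}"
  shows "card (free n A) + card A = n"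
proof -
  define g where "g x = (if x \<le> n then x else 2 * n + 1 - x)" for x
  have A': "2 * n + 1 - x \<notin> A" if "x \<in> A" for x
    using that A isotropic_iff_singles by (auto simp: singles_def)
  have "inj_on g A"
  proof (rule inj_onI)
    fix x y assume xy: "x \<in> A" "y \<in> A" "g x = g y"
    then have "x \<in> {1..2 * n}" "y \<in> {1..2 * n}" "x + y \<noteq> 2 * n + 1"
      using A by (auto simp: isotropic_def)
    with xy(3) show "x = y" by (auto simp: g_def split: if_splits)
  qed
  then have "card (g ` A) = card A" by (rule card_image)
  moreover have "{1..n} = free n A \<union> g ` A"
  proof (rule Set.set_eqI)
    fix i
    have "i \<in> g ` A" if "i \<in> {1..n}" "i \<in> A \<or> 2 * n + 1 - i \<in> A"
    proof -
      have "i = g i" "i = g (2 * n + 1 - i)" using that(1) by (auto simp: g_def)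
      with that(2) show ?thesis by (metis imageI)
    qed
    moreover have "i \<in> {1..n}" if i: "i \<in> g ` A"
    proof -
      from i obtain x where "x \<in> A" "i = g x" by blast
      moreover have "1 \<le> x" "x \<le> 2 * n" using \<open>x \<in> A\<close> A(2) by auto
      ultimately show ?thesis by (auto simp: g_def)
    qed
    moreover have "i \<in> free n A \<longleftrightarrow> i \<in> {1..n} \<and> \<not> (i \<in> A \<or> 2 * n + 1 - i \<in> A)"
      by (auto simp: free_def)
    ultimately show "i \<in> {1..n} \<longleftrightarrow> i \<in> free n A \<union> g ` A" by blast
  qed
  moreover have "free n A \<inter> g ` A = {}"
  proof -
    have "g x \<notin> free n A" if "x \<in> A" for x
    proof (cases "x \<le> n")
      case False
      then have "2 * n + 1 - (2 * n + 1 - x) = x" using that A(2) by auto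
      with False that show ?thesis by (auto simp: g_def free_def)
    qed (use that in \<open>auto simp: g_def free_def\<close>)
    then show ?thesis by auto
  qed
  moreover have "finite (free n A)" "finite A"
    using A(2) finite_subset by (auto simp: free_def)
  ultimately show ?thesis
    by (metis card_Un_disjoint card_atLeastAtMost diff_Suc_1 finite_imageI)
qed

section \<open>The blocks of \<open>B\<close>\<close>

text \<open>A nonzero entry means that a whole new pair is added to \<alpha>, and this neither
  creates nor destroys unpaired entries. So B vanishes between different fibres.\<close>

lemma B_entry_nonzero_imp_unpaired_eq:
  assumes "\<alpha> \<in> index_set (n - 2) (2 * n)" "\<beta> \<in> index_set n (2 * n)" "n \<ge> 2"
    and "B_entry n \<alpha> \<beta> \<noteq> 0"
  shows "unpaired n \<alpha> = unpaired n \<beta>"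
proof -
  from assms(4) obtain i where i: "i \<in> {1..n}" "{i, 2 * n + 1 - i} \<union> set \<alpha> = set \<beta>"
    by (auto simp: B_entry_def Suc_diff_le split: if_splits)
  note \<alpha> = index_setD[OF assms(1)] and \<beta> = index_setD[OF assms(2)]
  have notin: "i \<notin> set \<alpha>" "2 * n + 1 - i \<notin> set \<alpha>"
  proof -
    \<comment> \<open>If one member of the pair were already in \<alpha>, then \<beta> would gain at
      most one element, but it gains two; n \<ge> 2 makes n - 2 exact.\<close>
    have "card (set \<beta>) \<le> Suc (card (set \<alpha>))" if "i \<in> set \<alpha> \<or> 2 * n + 1 - i \<in> set \<alpha>"
      unfolding i(2)[symmetric] using that by (auto simp: insert_absorb card_insert_if)
    then show "i \<notin> set \<alpha>" "2 * n + 1 - i \<notin> set \<alpha>" using \<alpha>(2) \<beta>(2) assms(3) by auto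
  qed
  have "2 * n + 1 - x \<noteq> i" "2 * n + 1 - x \<noteq> 2 * n + 1 - i" if "x \<in> set \<alpha>" for x
  proof -
    have "x \<le> 2 * n" "x \<noteq> i" "x \<noteq> 2 * n + 1 - i" using that notin \<alpha>(1) by auto
    then show "2 * n + 1 - x \<noteq> i" "2 * n + 1 - x \<noteq> 2 * n + 1 - i" using i(1) by auto
  qed
  then have "singles n (set \<beta>) = singles n (set \<alpha>)"
    using i(1) notin unfolding i(2)[symmetric] by (auto simp: singles_def)
  then show ?thesis
    using \<alpha>(4) \<beta>(4) unpaired_eq_iff set_unpaired
    by (metis sorted_wrt_filter unpaired_def)
qed

text \<open>With equal singles, \<beta> has exactly one pair more than \<alpha>. So inclusion of the
  pair sets leaves a single new index i, which is the witness for the entry of B.\<close>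

lemma B_entry_eq_incl_entry:
  assumes "\<alpha> \<in> index_set (n - 2) (2 * n)" "\<beta> \<in> index_set n (2 * n)" "n \<ge> 2"
    and eq: "unpaired n \<alpha> = unpaired n \<beta>"
  shows "B_entry n \<alpha> \<beta> = (incl_entry (pairs n (set \<alpha>)) (pairs n (set \<beta>)) :: 'b :: field)"
proof -
  note \<alpha> = index_setD[OF assms(1)] and \<beta> = index_setD[OF assms(2)]
  have singles: "singles n (set \<alpha>) = singles n (set \<beta>)"
    using eq by (metis set_unpaired)
  have "(\<exists>i\<in>{1..n}. {i, 2 * n - i + 1} \<union> set \<alpha> = set \<beta>) \<longleftrightarrow> pairs n (set \<alpha>) \<subseteq> pairs n (set \<beta>)"
  proof
    assume "\<exists>i\<in>{1..n}. {i, 2 * n - i + 1} \<union> set \<alpha> = set \<beta>"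
    then show "pairs n (set \<alpha>) \<subseteq> pairs n (set \<beta>)" by (auto simp: pairs_def)
  next
    assume sub: "pairs n (set \<alpha>) \<subseteq> pairs n (set \<beta>)"
    have "card (pairs n (set \<beta>)) = Suc (card (pairs n (set \<alpha>)))"
      using card_eq_singles_pairs[OF \<alpha>(1)] card_eq_singles_pairs[OF \<beta>(1)] singles \<alpha>(2) \<beta>(2) assms(3)
      by simp
    moreover have fin: "finite (pairs n (set \<alpha>))" "finite (pairs n (set \<beta>))"
      by (simp_all add: pairs_def)
    ultimately have "card (pairs n (set \<beta>) - pairs n (set \<alpha>)) = 1"
      using sub by (simp add: card_Diff_subset)
    then obtain i where "pairs n (set \<beta>) - pairs n (set \<alpha>) = {i}" by (auto simp: card_1_singleton_iff)
    then have i: "pairs n (set \<beta>) = insert i (pairs n (set \<alpha>))" using sub by auto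
    then have "i \<in> {1..n}" by (auto simp: pairs_def)
    moreover have "{i, 2 * n + 1 - i} \<union> set \<alpha> = set \<beta>"
      using decompose[OF \<alpha>(1)] decompose[OF \<beta>(1)] unfolding i singles by blast
    ultimately show "\<exists>i\<in>{1..n}. {i, 2 * n - i + 1} \<union> set \<alpha> = set \<beta>"
      by (intro bexI[of _ i]) (auto simp: Suc_diff_le)
  qed
  then show ?thesis by (simp add: B_entry_def incl_entry_def)
qed

text \<open>The singles are constant on a fibre, so by \<open>decompose\<close> only the pairs
  distinguish its members.\<close>

lemma inj_on_pairs_fibre: "inj_on (\<lambda>\<alpha>. pairs n (set \<alpha>)) (set (fibre n d a))"
proof (rule inj_onI)
  fix \<alpha> \<beta> assume *: "\<alpha> \<in> set (fibre n d a)" "\<beta> \<in> set (fibre n d a)" "pairs n (set \<alpha>) = pairs n (set \<beta>)"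
  then have \<alpha>: "\<alpha> \<in> index_set d (2 * n)" and \<beta>: "\<beta> \<in> index_set d (2 * n)"
    and "singles n (set \<alpha>) = singles n (set \<beta>)"
    by (auto simp: set_fibre simp flip: set_unpaired)
  then have "set \<alpha> = set \<beta>"
    using decompose[OF index_setD(1)[OF \<alpha>]] decompose[OF index_setD(1)[OF \<beta>]] *(3) by simp
  then show "\<alpha> = \<beta>"
    using index_setD(4)[OF \<alpha>] index_setD(4)[OF \<beta>] by (intro strict_sorted_equal) auto
qed

text \<open>Counting elements gives the size of the pair sets; surjectivity comes from adding the
  pairs of T to a. With injectivity, the fibre is a list of all k-subsets of the free
  indices.\<close>

lemma pairs_image_fibre:
  assumes a: "a \<in> set (admissible_list n s)"
  shows "(\<lambda>\<alpha>. pairs n (set \<alpha>)) ` set (fibre n (s + 2 * k) a) = {T. T \<subseteq> free n (set a) \<and> card T = k}"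
proof (intro equalityI subsetI)
  fix T assume "T \<in> (\<lambda>\<alpha>. pairs n (set \<alpha>)) ` set (fibre n (s + 2 * k) a)"
  then obtain \<alpha> where \<alpha>: "\<alpha> \<in> index_set (s + 2 * k) (2 * n)" "unpaired n \<alpha> = a" "T = pairs n (set \<alpha>)"
    by (auto simp: set_fibre)
  then have "singles n (set \<alpha>) = set a" by (auto simp flip: set_unpaired)
  moreover have "card (set a) = s" using a index_setD by (auto simp: set_admissible_list)
  ultimately show "T \<in> {T. T \<subseteq> free n (set a) \<and> card T = k}"
    using card_eq_singles_pairs[of "set \<alpha>" n] index_setD[OF \<alpha>(1)] \<alpha>(3)
      pairs_subset_free_singles[of n "set \<alpha>"] by auto
next
  fix T assume "T \<in> {T. T \<subseteq> free n (set a) \<and> card T = k}"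
  then have T: "T \<subseteq> free n (set a)" "card T = k" by auto
  have ai: "a \<in> index_set s (2 * n)" and iso: "isotropic n (set a)"
    using a by (auto simp: set_admissible_list)
  define S where "S = set a \<union> (T \<union> (\<lambda>i. 2 * n + 1 - i) ` T)"
  note * = iso index_setD(1)[OF ai] T(1)
  have S: "S \<subseteq> {1..2 * n}" "singles n S = set a" "pairs n S = T" "card S = s + 2 * k"
    unfolding S_def using extend_subset[OF *] singles_extend[OF *] pairs_extend[OF *]
      card_decompose[OF *(2,3)] index_setD(2)[OF ai] T(2) by auto
  define \<alpha> where "\<alpha> = sorted_list_of_set S"
  have \<alpha>: "\<alpha> \<in> index_set (s + 2 * k) (2 * n)"
    unfolding \<alpha>_def using S by (intro sorted_list_of_set_in_index_set)
  have set\<alpha>: "set \<alpha> = S"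
    using finite_subset[OF S(1)] by (simp add: \<alpha>_def)
  have "unpaired n \<alpha> = a"
    using unpaired_eq_iff[OF index_setD(4)[OF \<alpha>] index_setD(4)[OF ai]] S set\<alpha> by simp
  then show "T \<in> (\<lambda>\<alpha>. pairs n (set \<alpha>)) ` set (fibre n (s + 2 * k) a)"
    using \<alpha> S(3) set\<alpha> by (auto simp: set_fibre)
qed

text \<open>There are n - s = 2 k + 2 free indices; rows carry k pairs and columns k + 1.
  Relabelling by pair sets gives an inclusion matrix whose labels may only be ordered differently
  from \<open>subsets_list\<close>.\<close>

lemma perm_equiv_L_block:
  assumes a: "a \<in> set (admissible_list n s)" and n: "n = s + 2 * k + 2"
  shows "perm_equiv (L_block n a :: 'b :: field mat) (L_mat (k + 2))"
proof -
  have ai: "a \<in> index_set s (2 * n)" "isotropic n (set a)"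
    using a by (auto simp: set_admissible_list)
  define xs where "xs = sorted_list_of_set (free n (set a))"
  have "finite (free n (set a))" by (simp add: free_def)
  then have xs: "set xs = free n (set a)" "distinct xs" "length xs = 2 * k + 2"
    using card_free[OF ai(2) index_setD(1)[OF ai(1)]] index_setD(2)[OF ai(1)] n by (simp_all add: xs_def)
  have d: "n - 2 = s + 2 * k" "n = s + 2 * Suc k" using n by simp_all
  define R where "R = map (\<lambda>\<alpha>. pairs n (set \<alpha>)) (fibre n (n - 2) a)"
  define C where "C = map (\<lambda>\<alpha>. pairs n (set \<alpha>)) (fibre n n a)"
  have "L_block n a = (label_mat (B_entry n) (map id (fibre n (n - 2) a)) (map id (fibre n n a)) :: 'b mat)"
    by (simp add: L_block_def fibre_def incidence_mat_label_mat)
  also have "\<dots> = label_mat incl_entry R C"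
    unfolding R_def C_def
    by (rule label_mat_map_cong) (auto simp: set_fibre B_entry_eq_incl_entry n)
  finally have L: "L_block n a = (label_mat incl_entry R C :: 'b mat)" .
  have dist: "distinct R" "distinct C"
    by (simp_all add: R_def C_def distinct_map distinct_fibre inj_on_pairs_fibre)
  have "set R = set (subsets_list k xs)"
    using pairs_image_fibre[OF a, of k] xs by (simp add: R_def set_subsets_list d(1))
  moreover have "set C = set (subsets_list (Suc k) xs)"
    using pairs_image_fibre[OF a, of "Suc k"] xs d(2) by (simp add: C_def set_subsets_list)
  ultimately show ?thesis
    unfolding L L_mat_eq_incl_mat[OF xs(2,3)] incl_mat_def
    using dist xs by (intro perm_equiv_label_matI) (simp_all add: distinct_subsets_list)
qed

section \<open>The direct sum\<close>

text \<open>The only possible obstruction is x + x = 2 n + 1, which parity excludes.\<close>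

lemma length_admissible_list_1: "length (admissible_list n 1) = 2 * n"
proof -
  have "admissible_list n 1 = index_list 1 (2 * n)"
    unfolding admissible_list_def
    by (auto simp: filter_id_conv set_index_list index_set_def length_Suc_conv) presburger
  then show ?thesis by (simp add: length_index_list)
qed

text \<open>With no free index left, a contains exactly one member of each pair, and its part in
  {1..n} can be any subset. These sequences label the zero columns of B.\<close>

lemma length_admissible_list_top: "length (admissible_list n n) = 2 ^ n"
proof -
  have complementary: "2 * n + 1 - i \<in> set a \<longleftrightarrow> i \<notin> set a"
    if a: "a \<in> set (admissible_list n n)" and i: "i \<in> {1..n}" for a i
  proof -
    have ai: "a \<in> index_set n (2 * n)" and iso: "isotropic n (set a)"
      using a by (auto simp: set_admissible_list)
    have "card (free n (set a)) = 0"
      using card_free[OF iso index_setD(1)[OF ai]] index_setD(2)[OF ai] by simp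
    then have "free n (set a) = {}" by (simp add: free_def)
    moreover have "i + (2 * n + 1 - i) = 2 * n + 1" using i by simp
    ultimately show ?thesis using i iso unfolding free_def isotropic_def by blast
  qed
  have "inj_on (\<lambda>a. set a \<inter> {1..n}) (set (admissible_list n n))"
  proof (rule inj_onI)
    fix a b assume *: "a \<in> set (admissible_list n n)" "b \<in> set (admissible_list n n)"
      and eq: "set a \<inter> {1..n} = set b \<inter> {1..n}"
    have low: "x \<in> set a \<longleftrightarrow> x \<in> set b" if "x \<in> {1..n}" for x using eq that by blast
    note ai = *[unfolded set_admissible_list, THEN conjunct1]
    have "x \<in> set a \<longleftrightarrow> x \<in> set b" if "x \<in> {1..2 * n}" for x
    proof (cases "x \<le> n")
      case False
      then have x: "2 * n + 1 - x \<in> {1..n}" "2 * n + 1 - (2 * n + 1 - x) = x" using that by auto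
      then show ?thesis
        using complementary[OF *(1) x(1)] complementary[OF *(2) x(1)] low[OF x(1)] by simp
    qed (use that low in auto)
    then have "set a = set b" using index_setD(1)[OF ai(1)] index_setD(1)[OF ai(2)] by blast
    then show "a = b"
      using index_setD(4)[OF ai(1)] index_setD(4)[OF ai(2)] by (intro strict_sorted_equal) auto
  qed
  moreover have "(\<lambda>a. set a \<inter> {1..n}) ` set (admissible_list n n) = Pow {1..n}"
  proof (intro equalityI subsetI)
    fix T assume "T \<in> Pow {1..n}"
    then have T: "T \<subseteq> {1..n}" by simp
    \<comment> \<open>Each index missing from T is replaced by its partner.\<close>
    define S where "S = T \<union> (\<lambda>i. 2 * n + 1 - i) ` ({1..n} - T)"
    have S: "S \<subseteq> {1..2 * n}" using T by (fastforce simp: S_def)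
    have iso: "isotropic n S"
      unfolding isotropic_def
    proof (intro ballI notI)
      fix x y assume xy: "x \<in> S" "y \<in> S" "x + y = 2 * n + 1"
      have le: "i \<le> n" if "i \<in> T" for i using that T by auto
      \<comment> \<open>Two entries of T sum to at most 2 n and two reflected ones to at least 2 n +
        2; in a mixed case the same index would lie in T and outside it.\<close>
      consider "x \<in> T" "y \<in> T"
        | j where "x \<in> T" "y = 2 * n + 1 - j" "j \<in> {1..n} - T"
        | j where "y \<in> T" "x = 2 * n + 1 - j" "j \<in> {1..n} - T"
        | i j where "x = 2 * n + 1 - i" "y = 2 * n + 1 - j" "i \<in> {1..n}" "j \<in> {1..n}"
        using xy(1,2) unfolding S_def by blast
      then show False
      proof cases
        case 1
        then show ?thesis using xy(3) le[of x] le[of y] by simp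
      next
        case (2 j)
        then have "x = j" using xy(3) by auto
        with 2 show ?thesis by simp
      next
        case (3 j)
        then have "y = j" using xy(3) by auto
        with 3 show ?thesis by simp
      next
        case (4 i j)
        then show ?thesis using xy(3) by auto
      qed
    qed
    have "free n S = {}" by (auto simp: free_def S_def)
    then have "card S = n" using card_free[OF iso S] by simp
    then have "sorted_list_of_set S \<in> set (admissible_list n n)"
      using S iso finite_subset[OF S]
      by (simp add: set_admissible_list sorted_list_of_set_in_index_set)
    moreover have "set (sorted_list_of_set S) \<inter> {1..n} = T"
      using T finite_subset[OF S] by (fastforce simp: S_def)
    ultimately show "T \<in> (\<lambda>a. set a \<inter> {1..n}) ` set (admissible_list n n)" by blast
  qed auto
  ultimately have "card (set (admissible_list n n)) = card (Pow {1..n})"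
    by (metis card_image)
  then show ?thesis by (simp add: distinct_card distinct_admissible_list card_Pow)
qed

section \<open>Every index sequence lies over exactly one admissible sequence\<close>

lemma distinct_concat_map:
  assumes "distinct xs" "\<And>x. x \<in> set xs \<Longrightarrow> distinct (g x)"
    and "\<And>x y. x \<in> set xs \<Longrightarrow> y \<in> set xs \<Longrightarrow> x \<noteq> y \<Longrightarrow> set (g x) \<inter> set (g y) = {}"
  shows "distinct (concat (map g xs))"
  using assms
proof (induction xs)
  case (Cons x xs)
  then have "set (g x) \<inter> set (concat (map g xs)) = {}" by fastforce
  with Cons show ?case by simp
qed simp

lemma unpaired_in_admissible_list:
  assumes "\<alpha> \<in> index_set d (2 * n)"
  shows "unpaired n \<alpha> \<in> set (admissible_list n (length (unpaired n \<alpha>)))"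
    and "d = length (unpaired n \<alpha>) + 2 * card (pairs n (set \<alpha>))"
proof -
  note \<alpha> = index_setD[OF assms]
  have sorted: "sorted_wrt (<) (unpaired n \<alpha>)"
    using \<alpha>(4) by (simp add: unpaired_def sorted_wrt_filter)
  moreover have "set (unpaired n \<alpha>) \<subseteq> {1..2 * n}"
    using \<alpha>(1) by (auto simp: unpaired_def)
  ultimately show "unpaired n \<alpha> \<in> set (admissible_list n (length (unpaired n \<alpha>)))"
    using isotropic_singles[OF \<alpha>(1)] by (simp add: set_admissible_list index_set_def set_unpaired)
  have "length (unpaired n \<alpha>) = card (singles n (set \<alpha>))"
    using sorted by (metis distinct_card set_unpaired strict_sorted_iff)
  then show "d = length (unpaired n \<alpha>) + 2 * card (pairs n (set \<alpha>))"
    using card_eq_singles_pairs[OF \<alpha>(1)] \<alpha>(2) by simp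
qed

lemma unpaired_admissible: "\<beta> \<in> set (admissible_list n d) \<Longrightarrow> unpaired n \<beta> = \<beta>"
  by (metis index_setD(1,4) isotropic_iff_singles set_admissible_list unpaired_eq_iff)

lemma admissible_list_length: "a \<in> set (admissible_list n d) \<Longrightarrow> length a = d"
  by (simp add: set_admissible_list index_set_def)

lemma admissible_list_disjoint:
  "d \<noteq> e \<Longrightarrow> set (admissible_list n d) \<inter> set (admissible_list n e) = {}"
  using admissible_list_length by blast

theorem theorem3p2:
  fixes n r :: nat
  assumes "n \<ge> 5" and "odd n" and "r = (n + 1) div 2"
  shows "perm_equiv (B_mat n :: 'f :: field mat)
           (diag_block_mat
             (replicate (2 * n) (L_mat r)
              @ concat (map (\<lambda>k. map (L_block n) (admissible_list n (2 * (r - k) - 3))) [0..<r - 2])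
              @ [0\<^sub>m 0 (2 ^ n)]))
       \<and> (\<forall>k \<le> r - 3. \<forall>a \<in> set (admissible_list n (2 * (r - k) - 3)).
            perm_equiv (L_block n a :: 'f mat) (L_mat (k + 2)))"
proof
  have n: "n = 2 * r - 1" and r: "r \<ge> 3" using assms by (auto elim!: oddE)
  \<comment> \<open>With s = 2 (r - k) - 3 one has n = s + 2 k + 2. The range includes k = r - 2,
    where s = 1 and the block is equivalent to \<open>L_mat r\<close>.\<close>
  have block: "perm_equiv (L_block n a :: 'f mat) (L_mat (k + 2))"
    if "k \<le> r - 2" "a \<in> set (admissible_list n (2 * (r - k) - 3))" for k a
    using that n r by (intro perm_equiv_L_block) auto
  then show "\<forall>k \<le> r - 3. \<forall>a \<in> set (admissible_list n (2 * (r - k) - 3)).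
      perm_equiv (L_block n a :: 'f mat) (L_mat (k + 2))" by auto

  \<comment> \<open>The lengths n - 2, n - 4, ..., 3 of the block labels, in the order of the direct
    sum; length 1 goes in front for the copies of \<open>L_mat r\<close>.\<close>
  define ds where "ds = map (\<lambda>k. 2 * (r - k) - 3) [0..<r - 2]"
  have ds: "set (1 # ds) = {s. odd s \<and> s \<le> n - 2}"
  proof (intro equalityI subsetI)
    fix s assume s: "s \<in> {s. odd s \<and> s \<le> n - 2}"
    then obtain t where t: "s = 2 * t + 1" by (auto elim!: oddE)
    show "s \<in> set (1 # ds)"
    proof (cases "t = 0")
      case False
      with s t n have "s = 2 * (r - (r - 2 - t)) - 3" "r - 2 - t < r - 2" by auto
      then show ?thesis unfolding ds_def by auto
    qed (simp add: t)
  qed (use n r in \<open>auto simp: ds_def\<close>)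
  have "distinct (1 # ds)"
    using r by (auto simp: ds_def distinct_map inj_on_def)
  define as where "as = concat (map (admissible_list n) (1 # ds))"
  have dist_as: "distinct as"
    unfolding as_def using \<open>distinct (1 # ds)\<close>
    by (rule distinct_concat_map) (rule distinct_admissible_list, rule admissible_list_disjoint)
  have set_as: "a \<in> set as \<longleftrightarrow> odd (length a) \<and> length a \<le> n - 2 \<and> a \<in> set (admissible_list n (length a))" for a
  proof -
    have "a \<in> set as \<longleftrightarrow> (\<exists>s\<in>{s. odd s \<and> s \<le> n - 2}. a \<in> set (admissible_list n s))"
      unfolding as_def set_concat set_map ds by blast
    then show ?thesis using admissible_list_length[of a n] by auto
  qed

  \<comment> \<open>The summand for a as it is written in the direct sum: for length 1 the matrix
    \<open>L_mat r\<close> itself, otherwise a submatrix of B.\<close>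
  define M :: "nat list \<Rightarrow> 'f mat" where "M a = (if length a = 1 then L_mat r else L_block n a)" for a
  have "perm_equiv (label_mat (B_entry n) (fibre n (n - 2) a) (fibre n n a)) (M a)" if "a \<in> set as" for a
  proof (cases "length a = 1")
    case True
    have "2 * (r - (r - 2)) - 3 = 1" "r - 2 + 2 = r" using r by auto
    with block[of "r - 2" a] True that show ?thesis
      by (simp add: M_def L_block_def fibre_def incidence_mat_label_mat set_as)
  next
    case False
    then have "M a = label_mat (B_entry n) (fibre n (n - 2) a) (fibre n n a)"
      by (simp add: M_def L_block_def fibre_def incidence_mat_label_mat)
    then show ?thesis unfolding perm_equiv_label_mat_iff by blast
  qed
  then have "\<forall>a\<in>set as. \<exists>p. mset (fst p) = mset (fibre n (n - 2) a) \<and>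
      mset (snd p) = mset (fibre n n a) \<and> M a = label_mat (B_entry n) (fst p) (snd p)"
    unfolding perm_equiv_label_mat_iff by simp
  \<comment> \<open>P reorders the labels of each fibre so that the summand is literally a label
    matrix of \<open>B_entry\<close>, and the direct sum can be read off from concatenated
    labels.\<close>
  then obtain P where P: "\<And>a. a \<in> set as \<Longrightarrow> mset (fst (P a)) = mset (fibre n (n - 2) a)"
      "\<And>a. a \<in> set as \<Longrightarrow> mset (snd (P a)) = mset (fibre n n a)"
      "\<And>a. a \<in> set as \<Longrightarrow> M a = label_mat (B_entry n) (fst (P a)) (snd (P a))"
    unfolding bchoice_iff by blast
  have R: "set (fst (P a)) = {\<alpha> \<in> index_set (n - 2) (2 * n). unpaired n \<alpha> = a}" "distinct (fst (P a))"
    and C: "set (snd (P a)) = {\<beta> \<in> index_set n (2 * n). unpaired n \<beta> = a}" "distinct (snd (P a))"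
    if "a \<in> set as" for a
    using P(1,2)[OF that] set_fibre distinct_fibre mset_eq_setD mset_eq_imp_distinct_iff by metis+
  \<comment> \<open>The last pair has no rows; its columns are the sequences without any pair, which
    yields the 0 by 2^n summand.\<close>
  define ps where "ps = map P as @ [([], admissible_list n n)]"

  have "replicate (2 * n) (L_mat r) @
      concat (map (\<lambda>k. map (L_block n) (admissible_list n (2 * (r - k) - 3))) [0..<r - 2]) =
      map M as"
  proof -
    have "map M (admissible_list n 1) = map (\<lambda>_. L_mat r) (admissible_list n 1)"
      by (auto simp: M_def dest: admissible_list_length)
    also have "\<dots> = replicate (2 * n) (L_mat r)"
      by (simp only: map_replicate_const length_admissible_list_1)
    finally have 1: "map M (admissible_list n 1) = replicate (2 * n) (L_mat r)" .
    have "map M (admissible_list n d) = map (L_block n) (admissible_list n d)" if "d \<in> set ds" for d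
      using that \<open>distinct (1 # ds)\<close> by (auto simp: M_def dest!: admissible_list_length)
    then have 2: "map (\<lambda>d. map M (admissible_list n d)) ds =
        map (\<lambda>d. map (L_block n) (admissible_list n d)) ds"
      by (rule map_cong[OF refl])
    have "map M as = map M (admissible_list n 1) @ concat (map (\<lambda>d. map M (admissible_list n d)) ds)"
      by (simp add: as_def map_concat o_def)
    also have "\<dots> = replicate (2 * n) (L_mat r) @
        concat (map (\<lambda>d. map (L_block n) (admissible_list n d)) ds)"
      by (simp only: 1 2)
    finally show ?thesis by (simp add: ds_def o_def)
  qed
  moreover have "[0\<^sub>m 0 (2 ^ n)] = [label_mat (B_entry n) [] (admissible_list n n) :: 'f mat]"
    by (auto simp: length_admissible_list_top)
  ultimately have "replicate (2 * n) (L_mat r) @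
      concat (map (\<lambda>k. map (L_block n) (admissible_list n (2 * (r - k) - 3))) [0..<r - 2]) @
      [0\<^sub>m 0 (2 ^ n)] = map (\<lambda>p. label_mat (B_entry n) (fst p) (snd p) :: 'f mat) ps"
    by (simp add: ps_def P(3) flip: append_assoc)
  moreover have "diag_block_mat (map (\<lambda>p. label_mat (B_entry n) (fst p) (snd p) :: 'f mat) ps) =
      label_mat (B_entry n) (concat (map fst ps)) (concat (map snd ps))"
  proof (rule diag_block_mat_label_mat)
    have off: "B_entry n \<alpha> \<beta> = (0 :: 'f)"
      if "\<alpha> \<in> index_set (n - 2) (2 * n)" "\<beta> \<in> index_set n (2 * n)" "unpaired n \<alpha> \<noteq> unpaired n \<beta>" for \<alpha> \<beta>
      using B_entry_nonzero_imp_unpaired_eq[OF that(1,2)] that(3) assms(1) by fastforce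
    have "sorted_wrt (\<lambda>a b. a \<noteq> b) as" using dist_as by (induction as) auto
    then have "sorted_wrt (\<lambda>a b. (\<forall>x\<in>set (fst (P a)). \<forall>y\<in>set (snd (P b)). B_entry n x y = (0 :: 'f)) \<and>
        (\<forall>x\<in>set (fst (P b)). \<forall>y\<in>set (snd (P a)). B_entry n x y = (0 :: 'f))) as"
      by (rule sorted_wrt_mono_rel[rotated]) (auto simp: R C intro!: off)
    moreover have "B_entry n \<alpha> \<beta> = (0 :: 'f)"
      if "a \<in> set as" "\<alpha> \<in> set (fst (P a))" "\<beta> \<in> set (admissible_list n n)" for a \<alpha> \<beta>
    proof (rule off)
      show "\<beta> \<in> index_set n (2 * n)" using that by (simp add: set_admissible_list)
      \<comment> \<open>A zero column \<beta> is its own unpaired part and has length n, whereas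
        block labels have length at most n - 2.\<close>
      have "length a \<noteq> n" using that(1) assms(1) set_as by fastforce
      then show "unpaired n \<alpha> \<noteq> unpaired n \<beta>"
        using that R(1)[OF that(1)] admissible_list_length unpaired_admissible by fastforce
    qed (use that R in auto)
    ultimately show "sorted_wrt (\<lambda>p q. (\<forall>x\<in>set (fst p). \<forall>y\<in>set (snd q). B_entry n x y = (0 :: 'f)) \<and>
        (\<forall>x\<in>set (fst q). \<forall>y\<in>set (snd p). B_entry n x y = (0 :: 'f))) ps"
      by (auto simp: ps_def sorted_wrt_append sorted_wrt_map)
  qed
  \<comment> \<open>It remains to see that the concatenated labels list every row and every column
    of B exactly once.\<close>
  moreover have "perm_equiv (B_mat n) (label_mat (B_entry n) (concat (map fst ps)) (concat (map snd ps)) :: 'f mat)"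
    unfolding B_mat_def incidence_mat_label_mat
  proof (rule perm_equiv_label_matI)
    have rows: "concat (map fst ps) = concat (map (\<lambda>a. fst (P a)) as)"
      and cols: "concat (map snd ps) = concat (map (\<lambda>a. snd (P a)) as) @ admissible_list n n"
      by (simp_all add: ps_def o_def)
    have "distinct (concat (map (\<lambda>a. fst (P a)) as))" "distinct (concat (map (\<lambda>a. snd (P a)) as))"
      using dist_as by (rule distinct_concat_map; auto simp: R C)+
    moreover have "length (unpaired n \<beta>) < n" if "a \<in> set as" "\<beta> \<in> set (snd (P a))" for a \<beta>
      using that C(1)[OF that(1)] set_as[of a] assms(1) by auto
    then have "set (concat (map (\<lambda>a. snd (P a)) as)) \<inter> set (admissible_list n n) = {}"
      using unpaired_admissible admissible_list_length by fastforce
    ultimately show "distinct (concat (map fst ps))" "distinct (concat (map snd ps))"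
      unfolding rows cols by (auto simp: distinct_admissible_list)
    have "unpaired n \<alpha> \<in> set as" if "\<alpha> \<in> index_set (n - 2) (2 * n)" for \<alpha>
    proof -
      \<comment> \<open>Removing pairs preserves parity, so the unpaired part has odd length at most
        n - 2.\<close>
      have "odd (n - 2)" using assms by simp
      then show ?thesis
        using unpaired_in_admissible_list[OF that] unfolding set_as
        by (metis even_add even_mult_iff even_numeral le_add1)
    qed
    then show "set (index_list (n - 2) (2 * n)) = set (concat (map fst ps))"
      unfolding rows by (auto simp: set_index_list R)
    have "unpaired n \<beta> \<in> set as \<or> \<beta> \<in> set (admissible_list n n)" if \<beta>: "\<beta> \<in> index_set n (2 * n)" for \<beta>
    \<comment> \<open>A column without pairs is admissible of length n; one with a pair has an
      unpaired part of odd length at most n - 2.\<close>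
    proof (cases "card (pairs n (set \<beta>)) = 0")
      case True
      then have "length (unpaired n \<beta>) = length \<beta>"
        using unpaired_in_admissible_list(2)[OF \<beta>] index_setD(3)[OF \<beta>] by simp
      then have "unpaired n \<beta> = \<beta>"
        unfolding unpaired_def by (metis filter_id_conv length_filter_less nat_neq_iff)
      then show ?thesis
        using unpaired_in_admissible_list(1)[OF \<beta>] index_setD(3)[OF \<beta>] by simp
    next
      case False
      have "n = length (unpaired n \<beta>) + 2 * card (pairs n (set \<beta>))"
        using unpaired_in_admissible_list(2)[OF \<beta>] .
      with False have "length (unpaired n \<beta>) \<le> n - 2" "odd (length (unpaired n \<beta>))"
        using assms(2) by (linarith, metis even_add even_mult_iff even_numeral)
      then show ?thesis
        using unpaired_in_admissible_list(1)[OF \<beta>] unfolding set_as by blast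
    qed
    then show "set (index_list n (2 * n)) = set (concat (map snd ps))"
      unfolding cols by (fastforce simp: set_index_list C set_admissible_list)
  qed (simp_all add: distinct_index_list)
  ultimately show "perm_equiv (B_mat n :: 'f mat)
      (diag_block_mat (replicate (2 * n) (L_mat r)
        @ concat (map (\<lambda>k. map (L_block n) (admissible_list n (2 * (r - k) - 3))) [0..<r - 2])
        @ [0\<^sub>m 0 (2 ^ n)]))"
    by simp
qed

end
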